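(* Let $\{X_t^{(\lambda)}\}_{\lambda\in\mathbb{R}^+}$ be a $\lambda$-parametrized family of stochastic processes on $[0,T]$ started at $0$ at time $0$ and having transition probability density $$Q^{(\lambda)}(x,t\,|\,0,0)=e^{-\lambda t}\,\frac{h^{(\lambda)}(x)}{h^{(\lambda)}(0)}\,q(x,t\,|\,0,0),$$ with $q$ and $h^{(\lambda)}$ as described in the context. Let $R^{(\lambda)}(x):=\frac{\partial}{\partial\lambda}h^{(\lambda)}(x)$ and $$\mathcal{P}^{(\lambda)}(x,t):=\int_{-\infty}^{x}Q^{(\lambda)}(y,t\,|\,0,0)\,dy .$$ If $$R^{(\lambda)}(x)=R^{(\lambda)}(-x)\ge 0\qquad\text{for all }x\in\mathbb{R},$$ then the family satisfies the two DMPS integral conditions $$\text{(i)}\quad \frac{\partial}{\partial\lambda}\left[\int_{\mathbb{R}}\mathcal{P}^{(\lambda)}(x,t)\,dx\right]=0,\qquad\qquad \text{(ii)}\quad \frac{\partial}{\partial\lambda}\left[\int_{-\infty}^{x}\mathcal{P}^{(\lambda)}(y,t)\,dy\right]\ge 0,$$ for all $x\in\mathbb{R}$, $\lambda\in\mathbb{R}^+$ and $t\in[0,T]$.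
   Context: Base diffusion: $dX_t=b(X_t)\,dt+\sigma\,dW_t$ on $[0,T]$, where $W$ is a standard Brownian motion, $\sigma\in\mathbb{R}$, and $b:\mathbb{R}\to\mathbb{R}$ is at least $\mathcal{C}^2$ with bounded first and second derivatives and is odd: $b(x)=-b(-x)$. Its transition probability density is $q(x,t\,|\,x_0,s)$; by symmetry $q(x,t\,|\,0,0)=q(-x,t\,|\,0,0)$. Its diffusion operator is $\mathcal{L}_x\varphi=\frac{\sigma^2}{2}\varphi''+b\,\varphi'$. For each $\lambda\in\mathbb{R}^+$, $h^{(\lambda)}:\mathbb{R}\to\mathbb{R}$ is a nonnegative even function (with $h^{(\lambda)}(0)>0$), differentiable in $\lambda$, with $\mathcal{L}_x h^{(\lambda)}=\lambda h^{(\lambda)}$. The process $e^{-\lambda t}h^{(\lambda)}(X_t)/h^{(\lambda)}(0)$ is a martingale with expectation $1$ (for the base diffusion started at $0$), so that $Q^{(\lambda)}(\cdot,t\,|\,0,0)$ is a normalized probability density. Since $\int_{\mathbb{R}}\mathcal{P}^{(\lambda)}(x,t)\,dx$ is the integral of a distribution function, the derivative in (i) is understood as taken inside the integral, i.e. (i) means $\int_{\mathbb{R}}\frac{\partial}{\partial\lambda}\mathcal{P}^{(\lambda)}(x,t)\,dx=0$. *)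

theory Defs
  imports "HOL-Probability.Probability"
begin

definition twice_differentiable :: "(real \<Rightarrow> real) \<Rightarrow> bool" where
  "twice_differentiable f \<longleftrightarrow>
     (\<forall>x. f differentiable (at x)) \<and> (\<forall>x. deriv f differentiable (at x))"

definition admissible_drift :: "(real \<Rightarrow> real) \<Rightarrow> bool" where
  "admissible_drift b \<longleftrightarrow>
     twice_differentiable b \<and> continuous_on UNIV (deriv (deriv b)) \<and>
     bounded (range (deriv b)) \<and> bounded (range (deriv (deriv b))) \<and>
     (\<forall>x. b x = - b (- x))"

definition filtered_prob_space :: "'a measure \<Rightarrow> (real \<Rightarrow> 'a measure) \<Rightarrow> bool" where
  "filtered_prob_space M F \<longleftrightarrow>
     prob_space M \<and> filtration (space M) F \<and> (\<forall>t. subalgebra M (F t))"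

definition brownian_motion ::
    "'a measure \<Rightarrow> (real \<Rightarrow> 'a measure) \<Rightarrow> real \<Rightarrow> (real \<Rightarrow> 'a \<Rightarrow> real) \<Rightarrow> bool" where
  "brownian_motion M F T W \<longleftrightarrow>
     (\<forall>t\<in>{0..T}. W t \<in> borel_measurable (F t)) \<and>
     (AE \<omega> in M. W 0 \<omega> = 0) \<and>
     (AE \<omega> in M. continuous_on {0..T} (\<lambda>t. W t \<omega>)) \<and>
     (\<forall>s t. 0 \<le> s \<and> s < t \<and> t \<le> T \<longrightarrow>
        distributed M lborel (\<lambda>\<omega>. W t \<omega> - W s \<omega>)
          (\<lambda>x. ennreal (normal_density 0 (sqrt (t - s)) x)) \<and>
        prob_space.indep_set M (sets (F s))
          {(\<lambda>\<omega>. W t \<omega> - W s \<omega>) -` A \<inter> space M | A. A \<in> sets borel})"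

text \<open>
  Solutions on \<open>[s, T]\<close>, started at \<open>x0\<close> at time \<open>s\<close>, of \<open>dX = b(X) dt + \<sigma> dW\<close>. Since
  \<open>\<sigma>\<close> is a constant, the stochastic integral is \<open>\<sigma> (W t - W s)\<close> and the equation can be
  read path by path.
\<close>

definition sde_solution ::
    "'a measure \<Rightarrow> (real \<Rightarrow> 'a measure) \<Rightarrow> real \<Rightarrow> (real \<Rightarrow> 'a \<Rightarrow> real) \<Rightarrow> (real \<Rightarrow> real) \<Rightarrow> real
      \<Rightarrow> real \<Rightarrow> real \<Rightarrow> (real \<Rightarrow> 'a \<Rightarrow> real) \<Rightarrow> bool" where
  "sde_solution M F T W b \<sigma> s x0 X \<longleftrightarrow>
     (\<forall>t\<in>{s..T}. X t \<in> borel_measurable (F t)) \<and>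
     (AE \<omega> in M. continuous_on {s..T} (\<lambda>t. X t \<omega>) \<and>
        (\<forall>t\<in>{s..T}. X t \<omega> = x0 + integral {s..t} (\<lambda>u. b (X u \<omega>)) + \<sigma> * (W t \<omega> - W s \<omega>)))"

text \<open>\<open>q x t x0 s\<close> stands for \<open>q(x, t | x0, s)\<close>.\<close>

definition transition_density ::
    "'a measure \<Rightarrow> (real \<Rightarrow> 'a measure) \<Rightarrow> real \<Rightarrow> (real \<Rightarrow> 'a \<Rightarrow> real) \<Rightarrow> (real \<Rightarrow> real) \<Rightarrow> real
      \<Rightarrow> (real \<Rightarrow> real \<Rightarrow> real \<Rightarrow> real \<Rightarrow> real) \<Rightarrow> bool" where
  "transition_density M F T W b \<sigma> q \<longleftrightarrow>
     (\<forall>s t x0. 0 \<le> s \<and> s < t \<and> t \<le> T \<longrightarrow>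
        (\<forall>x. 0 \<le> q x t x0 s) \<and>
        (\<forall>X. sde_solution M F T W b \<sigma> s x0 X \<longrightarrow>
           distributed M lborel (X t) (\<lambda>x. ennreal (q x t x0 s))))"

definition martingale_on ::
    "'a measure \<Rightarrow> (real \<Rightarrow> 'a measure) \<Rightarrow> real \<Rightarrow> (real \<Rightarrow> 'a \<Rightarrow> real) \<Rightarrow> bool" where
  "martingale_on M F T Z \<longleftrightarrow>
     (\<forall>t\<in>{0..T}. Z t \<in> borel_measurable (F t) \<and> integrable M (Z t)) \<and>
     (\<forall>s t. 0 \<le> s \<and> s \<le> t \<and> t \<le> T \<longrightarrow> (AE \<omega> in M. real_cond_exp M (F s) (Z t) \<omega> = Z s \<omega>))"

definition diffusion_operator ::
    "(real \<Rightarrow> real) \<Rightarrow> real \<Rightarrow> (real \<Rightarrow> real) \<Rightarrow> real \<Rightarrow> real" where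
  "diffusion_operator b \<sigma> \<phi> x = \<sigma>\<^sup>2 / 2 * deriv (deriv \<phi>) x + b x * deriv \<phi> x"

definition eigenfunction_family ::
    "(real \<Rightarrow> real) \<Rightarrow> real \<Rightarrow> (real \<Rightarrow> real \<Rightarrow> real) \<Rightarrow> bool" where
  "eigenfunction_family b \<sigma> h \<longleftrightarrow>
     (\<forall>l>0. (\<forall>x. 0 \<le> h l x) \<and> (\<forall>x. h l (- x) = h l x) \<and> 0 < h l 0 \<and>
        (\<forall>x. (\<lambda>k. h k x) differentiable (at l)) \<and>
        twice_differentiable (h l) \<and>
        (\<forall>x. diffusion_operator b \<sigma> (h l) x = l * h l x))"

definition tilted_density ::
    "(real \<Rightarrow> real \<Rightarrow> real \<Rightarrow> real \<Rightarrow> real) \<Rightarrow> (real \<Rightarrow> real \<Rightarrow> real) \<Rightarrow> real \<Rightarrow> real \<Rightarrow> real \<Rightarrow> real" where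
  "tilted_density q h l x t = exp (- l * t) * (h l x / h l 0) * q x t 0 0"

text \<open>
  At time \<open>0\<close> the process sits at \<open>0\<close>, so \<open>q(\<cdot>, 0 | 0, 0)\<close> is the Dirac mass at \<open>0\<close>, which is
  not a function. The distribution function at time \<open>0\<close> is therefore given explicitly as that
  of the Dirac mass.
\<close>

definition tilted_cdf ::
    "(real \<Rightarrow> real \<Rightarrow> real \<Rightarrow> real \<Rightarrow> real) \<Rightarrow> (real \<Rightarrow> real \<Rightarrow> real) \<Rightarrow> real \<Rightarrow> real \<Rightarrow> real \<Rightarrow> real" where
  "tilted_cdf q h l x t =
     (if t = 0 then (if 0 \<le> x then 1 else 0)
      else (LBINT y:{..x}. tilted_density q h l y t))"

definition eigenfunction_sensitivity :: "(real \<Rightarrow> real \<Rightarrow> real) \<Rightarrow> real \<Rightarrow> real \<Rightarrow> real" where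
  "eigenfunction_sensitivity h l x = deriv (\<lambda>k. h k x) l"

end

theory Submission
  imports Defs
begin

text \<open>
  Fix a time \<open>t > 0\<close> (at \<open>t = 0\<close> the distribution function does not depend on the parameter) and write
  \<open>u l = h l / h l 0\<close>, so that the tilted density is \<open>exp (- l t) u l q\<close>. It is an even probability
  density for every \<open>l > 0\<close>. For a weight \<open>\<psi>\<close> of at most quadratic growth, the weighted integral
  \<open>\<integral> \<psi> exp (- l t) u l q\<close> turns out to be differentiable in \<open>l\<close> under the integral sign, and both
  conditions are statements about such integrals.

  Condition (i): the parameter derivative of the distribution function is the primitive of the
  parameter derivative of the density. That derivative has mass \<open>0\<close>, because the mass of the density
  is always \<open>1\<close>, and first moment \<open>0\<close>, because the density is even. By Fubini's theorem the integral
  of the primitive of a function of mass \<open>0\<close> is minus its first moment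
  (\<open>integral_primitive_of_null_function\<close>).

  Condition (ii): the integral of the distribution function up to \<open>x\<close> is the integral of
  \<open>max 0 (x - y)\<close> against the density, so the claim is that the densities increase in convex order.
  For \<open>l < k\<close> the ratio \<open>u k / u l\<close> is monotone in \<open>\<bar>x\<bar>\<close> (\<open>ratio_mono\<close>), because the Wronskian
  of the two eigenfunctions is nonnegative on the half-line. Hence the two even densities cross at most
  once in \<open>\<bar>x\<bar>\<close>, the larger parameter having more mass outside, and the classical single-crossing
  criterion applies (\<open>even_weight_mono\<close>).

  The analytic work is the domination that justifies these steps. The only integrability at hand is
  that of \<open>u m q\<close> for every \<open>m > 0\<close>, so everything is dominated by eigenfunctions with larger
  parameters. A comparison principle for \<open>a w'' + b w' \<ge> l w\<close> (\<open>subsolution_positive\<close>) bounds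
  the increments in the parameter, \<open>\<bar>u k - u l\<bar> \<le> \<bar>k - l\<bar> u m\<close> (\<open>u_lipschitz_parameter\<close>),
  and shows that a quadratic weight only raises the parameter, \<open>(1 + x\<^sup>2) u l \<le> 2 u m\<close>
  (\<open>quadratic_weight_absorbed\<close>). The latter uses the linear growth of the drift.
\<close>

section \<open>Comparison for second-order differential inequalities\<close>

text \<open>
  A function that starts nonnegative and crosses every zero upwards cannot become negative: just
  after the last nonnegative point before a negative value, it would have to be both increasing
  and negative. Applied below to first derivatives and to first-order combinations of solutions,
  this lemma takes the place of an integrating factor.
\<close>

lemma nonneg_if_increasing_at_zeros:
  fixes f f' :: "real \<Rightarrow> real"
  assumes der: "\<And>x. 0 \<le> x \<Longrightarrow> x < y \<Longrightarrow> (f has_real_derivative f' x) (at x)"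
    and f0: "0 \<le> f 0"
    and up: "\<And>x. 0 \<le> x \<Longrightarrow> x < y \<Longrightarrow> f x = 0 \<Longrightarrow> 0 < f' x"
    and x: "0 \<le> x" "x < y"
  shows "0 \<le> f x"
proof (rule ccontr)
  assume neg: "\<not> 0 \<le> f x"
  define S where "S = {z \<in> {0..x}. f z \<in> {0..}}"
  have cont: "continuous_on {0..x} f"
    using der x by (intro DERIV_continuous_on[where D = f'])
      (auto intro: has_field_derivative_at_within)
  have "closed ({0..x} \<inter> f -` {0..})"
    by (intro continuous_closed_preimage cont) auto
  then have "closed S"
    by (simp add: S_def vimage_def Int_def)
  moreover have "bounded S"
    by (rule bounded_subset[of "{0..x}"]) (auto simp: S_def)
  ultimately have "compact S"
    by (simp add: compact_eq_bounded_closed)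
  moreover have "0 \<in> S"
    using f0 x by (simp add: S_def)
  ultimately obtain c where c: "c \<in> S" and c_max: "\<And>z. z \<in> S \<Longrightarrow> z \<le> c"
    using compact_attains_sup[of S] by blast
  have "c \<noteq> x"
    using c neg by (auto simp: S_def)
  then have c_range: "0 \<le> c" "c < x" and fc: "0 \<le> f c"
    using c by (auto simp: S_def)
  have "f c = 0"
  proof -
    have "continuous_on {c..x} f"
      by (rule continuous_on_subset[OF cont]) (use c_range in auto)
    then obtain z where z: "c \<le> z" "z \<le> x" "f z = 0"
      using IVT2'[of f x 0 c] fc neg c_range by auto
    then have "z \<in> S"
      using c_range by (simp add: S_def)
    with c_max z have "z = c"
      by force
    with z show ?thesis
      by simp
  qed
  then obtain d where d: "0 < d" "\<And>s. 0 < s \<Longrightarrow> s < d \<Longrightarrow> f c < f (c + s)"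
    using DERIV_pos_inc_right[of f "f' c" c] der[of c] up[of c] c_range x by auto
  define s where "s = min (d / 2) (x - c)"
  have s: "0 < s" "s < d" "c + s \<le> x"
    using d c_range by (auto simp: s_def)
  then have "c + s \<in> S"
    using d(2)[of s] fc c_range by (auto simp: S_def)
  with c_max s show False
    by force
qed

text \<open>
  As long as \<open>w > 0\<close>, every zero of \<open>w'\<close> has \<open>a w'' \<ge> l w > 0\<close>, so \<open>w'\<close> is crossing upwards there
  and stays nonnegative; hence \<open>w\<close> increases from \<open>w 0 > 0\<close> and can never reach \<open>0\<close>. The
  drift does not interfere, as its term vanishes together with \<open>w'\<close>.
\<close>

lemma subsolution_positive:
  fixes w w' w'' b :: "real \<Rightarrow> real"
  assumes "0 < a" "0 < l"
    and dw: "\<And>x. 0 \<le> x \<Longrightarrow> (w has_real_derivative w' x) (at x)"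
    and dw': "\<And>x. 0 \<le> x \<Longrightarrow> (w' has_real_derivative w'' x) (at x)"
    and w0: "0 < w 0" and w'0: "0 \<le> w' 0"
    and sub: "\<And>x. 0 \<le> x \<Longrightarrow> l * w x \<le> a * w'' x + b x * w' x"
    and "0 \<le> x"
  shows "0 < w x" and "0 \<le> w' x"
proof -
  have increasing: "0 \<le> w' z"
    if pos: "\<And>z. 0 \<le> z \<Longrightarrow> z < y \<Longrightarrow> 0 < w z" and z: "0 \<le> z" "z < y" for y z
  proof (rule nonneg_if_increasing_at_zeros[where f = w' and f' = w'' and y = y])
    fix z assume z: "0 \<le> z" "z < y" "w' z = 0"
    have "0 < l * w z"
      using pos z \<open>0 < l\<close> by simp
    also have "\<dots> \<le> a * w'' z"
      using sub[of z] z by simp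
    finally show "0 < w'' z"
      using \<open>0 < a\<close> by (simp add: zero_less_mult_iff)
  qed (use dw' w'0 z in auto)
  have pos: "0 < w x" if "0 \<le> x" for x
  proof (rule ccontr)
    assume neg: "\<not> 0 < w x"
    define S where "S = {z \<in> {0..x}. w z \<in> {..0}}"
    have cont: "continuous_on {0..x} w"
      using dw by (intro DERIV_continuous_on[where D = w'])
        (auto intro: has_field_derivative_at_within)
    have "closed ({0..x} \<inter> w -` {..0})"
      by (intro continuous_closed_preimage cont) auto
    then have "closed S"
      by (simp add: S_def vimage_def Int_def)
    moreover have "bounded S"
      by (rule bounded_subset[of "{0..x}"]) (auto simp: S_def)
    ultimately have "compact S"
      by (simp add: compact_eq_bounded_closed)
    moreover have "x \<in> S"
      using neg that by (simp add: S_def)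
    ultimately obtain y where y: "y \<in> S" and y_min: "\<And>z. z \<in> S \<Longrightarrow> y \<le> z"
      using compact_attains_inf[of S] by blast
    have "y \<noteq> 0"
      using y w0 by (auto simp: S_def)
    then have y_range: "0 < y" "y \<le> x" and wy: "w y \<le> 0"
      using y by (auto simp: S_def)
    have before: "0 < w z" if "0 \<le> z" "z < y" for z
      using y_min[of z] that y_range by (fastforce simp: S_def)
    obtain z where z: "0 < z" "z < y" "w y - w 0 = (y - 0) * w' z"
      using MVT2[of 0 y w w'] y_range dw by auto
    moreover have "0 \<le> w' z"
      using increasing[of y z] before z by simp
    ultimately have "0 \<le> w y - w 0"
      using y_range by simp
    with wy w0 show False
      by simp
  qed
  show "0 < w x"
    using pos assms by simp
  show "0 \<le> w' x"
    using increasing[of "x + 1" x] pos assms by simp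
qed

section \<open>Dependence of the eigenfunctions on the eigenvalue\<close>

text \<open>
  The functions \<open>u l\<close> are the eigenfunctions normalized to \<open>1\<close> at the origin, \<open>u' l\<close> and \<open>u'' l\<close> are
  their derivatives in space, and \<open>a\<close> is \<open>\<sigma>\<^sup>2 / 2\<close>. The normalization makes
  \<open>u l\<close> the solution of an initial value problem, so that two eigenfunctions can be compared
  from \<open>0\<close> outwards.
\<close>

locale even_eigenfunctions =
  fixes a K :: real and b :: "real \<Rightarrow> real" and u u' u'' :: "real \<Rightarrow> real \<Rightarrow> real"
  assumes a_pos: "0 < a" and K_nonneg: "0 \<le> K"
    and drift_bound: "\<And>x. 0 \<le> x \<Longrightarrow> \<bar>b x\<bar> \<le> K * x"
    and du: "\<And>l x. 0 < l \<Longrightarrow> (u l has_real_derivative u' l x) (at x)"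
    and du': "\<And>l x. 0 < l \<Longrightarrow> (u' l has_real_derivative u'' l x) (at x)"
    and eigen: "\<And>l x. 0 < l \<Longrightarrow> a * u'' l x + b x * u' l x = l * u l x"
    and u_0: "\<And>l. 0 < l \<Longrightarrow> u l 0 = 1" and u'_0: "\<And>l. 0 < l \<Longrightarrow> u' l 0 = 0"
    and u_even: "\<And>l x. 0 < l \<Longrightarrow> u l (- x) = u l x"
begin

lemma u_abs: "0 < l \<Longrightarrow> u l \<bar>x\<bar> = u l x"
  by (simp add: abs_if u_even)

lemma u_pos: "0 < l \<Longrightarrow> 0 < u l x"
  using subsolution_positive(1)[of a l "u l" "u' l" "u'' l" b "\<bar>x\<bar>"]
  by (simp add: a_pos du du' u_0 u'_0 eigen u_abs)

lemma continuous_u: "0 < l \<Longrightarrow> continuous_on A (u l)"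
  by (rule DERIV_continuous_on[where D = "u' l"]) (auto intro: has_field_derivative_at_within du)

text \<open>
  Whenever the Wronskian of \<open>u k\<close> and \<open>u l\<close> vanishes, the drift terms cancel and its derivative is
  \<open>(k - l) u k u l / a > 0\<close>.
\<close>

lemma wronskian_nonneg:
  assumes "0 < l" "l < k" "0 \<le> x"
  shows "0 \<le> u' k x * u l x - u k x * u' l x"
proof -
  let ?D' = "\<lambda>x. u'' k x * u l x - u k x * u'' l x"
  show ?thesis
  proof (rule nonneg_if_increasing_at_zeros[where f' = ?D' and y = "x + 1"
        and f = "\<lambda>x. u' k x * u l x - u k x * u' l x"])
    fix z :: real
    show "((\<lambda>x. u' k x * u l x - u k x * u' l x) has_real_derivative ?D' z) (at z)"
      using assms by (auto intro!: derivative_eq_intros du du')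
    assume zero: "u' k z * u l z - u k z * u' l z = 0"
    have "a * ?D' z = u l z * (a * u'' k z) - u k z * (a * u'' l z)"
      by (simp add: algebra_simps)
    also have "a * u'' k z = k * u k z - b z * u' k z"
      using eigen[of k z] assms by simp
    also have "a * u'' l z = l * u l z - b z * u' l z"
      using eigen[of l z] assms by simp
    also have "u l z * (k * u k z - b z * u' k z) - u k z * (l * u l z - b z * u' l z)
        = (k - l) * u k z * u l z - b z * (u' k z * u l z - u k z * u' l z)"
      by (simp add: algebra_simps)
    also have "\<dots> = (k - l) * u k z * u l z"
      by (simp add: zero)
    also have "\<dots> > 0"
      using assms by (simp add: u_pos)
    finally show "0 < ?D' z"
      using a_pos by (simp add: zero_less_mult_iff)
  qed (use assms u_0 u'_0 in auto)
qed

text \<open>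
  The likelihood ratio of two members of the family is monotone in \<open>\<bar>x\<bar>\<close>, since the numerator of
  its derivative is the Wronskian. This is what makes the member with the larger parameter
  more spread out.
\<close>

lemma ratio_mono:
  assumes "0 < l" "l < k" "\<bar>x\<bar> \<le> \<bar>y\<bar>"
  shows "u k x / u l x \<le> u k y / u l y"
proof -
  have "u k \<bar>x\<bar> / u l \<bar>x\<bar> \<le> u k \<bar>y\<bar> / u l \<bar>y\<bar>"
  proof (rule DERIV_nonneg_imp_nondecreasing[OF assms(3)])
    fix z assume "\<bar>x\<bar> \<le> z"
    then have "0 \<le> z"
      by simp
    have "((\<lambda>z. u k z / u l z) has_real_derivative
        (u' k z * u l z - u k z * u' l z) / (u l z * u l z)) (at z)"
      using assms u_pos[of l z] by (auto intro!: derivative_eq_intros du)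
    moreover have "0 \<le> (u' k z * u l z - u k z * u' l z) / (u l z * u l z)"
      using wronskian_nonneg[OF assms(1,2) \<open>0 \<le> z\<close>] by simp
    ultimately show "\<exists>D. ((\<lambda>z. u k z / u l z) has_real_derivative D) (at z) \<and> 0 \<le> D"
      by blast
  qed
  with assms show ?thesis
    by (simp add: u_abs)
qed

lemma u_mono_parameter:
  assumes "0 < l" "l \<le> k"
  shows "u l x \<le> u k x"
proof (cases "l = k")
  case False
  then have "1 \<le> u k x / u l x"
    using ratio_mono[of l k 0 x] assms by (simp add: u_0)
  then show ?thesis
    using u_pos[of l x] assms by simp
qed simp

text \<open>
  Difference quotients in the parameter are dominated by a single eigenfunction with a larger
  parameter. For \<open>k < l\<close>, the function \<open>(l - k) u m - (u l - u k)\<close> is a subsolution for the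
  parameter \<open>k\<close>, with source term \<open>(l - k) ((m - k) u m - u l)\<close>; the gap of \<open>1\<close> between \<open>m\<close> and
  the other parameters makes the source nonnegative.
\<close>

lemma u_lipschitz_parameter:
  assumes "0 < k" "0 < l" "k + 1 \<le> m" "l + 1 \<le> m"
  shows "\<bar>u k x - u l x\<bar> \<le> \<bar>k - l\<bar> * u m x"
proof -
  have le: "u l x - u k x \<le> (l - k) * u m x"
    if k: "0 < k" "k < l" "l + 1 \<le> m" for k l
  proof -
    define w where "w x = (l - k) * u m x - (u l x - u k x)" for x
    define w' where "w' x = (l - k) * u' m x - (u' l x - u' k x)" for x
    define w'' where "w'' x = (l - k) * u'' m x - (u'' l x - u'' k x)" for x
    have "0 < w \<bar>x\<bar>"
    proof (rule subsolution_positive(1)[where a = a and l = k and w = w and w' = w' and w'' = w'' and b = b])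
      fix z :: real
      show "(w has_real_derivative w' z) (at z)" "(w' has_real_derivative w'' z) (at z)"
        unfolding w_def w'_def w''_def using k by (auto intro!: derivative_eq_intros du du')
      have "a * w'' z + b z * w' z =
          (l - k) * (a * u'' m z + b z * u' m z) - (a * u'' l z + b z * u' l z)
            + (a * u'' k z + b z * u' k z)"
        by (simp add: w''_def w'_def algebra_simps)
      also have "\<dots> = (l - k) * (m * u m z) - l * u l z + k * u k z"
        using k by (simp add: eigen)
      also have "\<dots> = k * w z + (l - k) * ((m - k) * u m z - u l z)"
        by (simp add: w_def algebra_simps)
      also have "\<dots> \<ge> k * w z"
      proof -
        have "u l z \<le> u m z"
          using k by (intro u_mono_parameter) auto
        also have "\<dots> \<le> (m - k) * u m z"
          using k u_pos[of m z] mult_right_mono[of 1 "m - k" "u m z"] by simp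
        finally show ?thesis
          using k by simp
      qed
      finally show "k * w z \<le> a * w'' z + b z * w' z" .
    qed (use k a_pos in \<open>auto simp: w_def w'_def u_0 u'_0\<close>)
    with k show ?thesis
      by (simp add: w_def u_abs)
  qed
  have "u (min k l) x \<le> u (max k l) x"
    using assms by (intro u_mono_parameter) auto
  with le[of k l] le[of l k] assms show ?thesis
    by (cases k l rule: linorder_cases) auto
qed

text \<open>
  This follows the Riccati equation of \<open>u' l / u l\<close> without dividing: where \<open>u' = A x u\<close>, the
  equation \<open>a u'' = l u - b u'\<close> and \<open>\<bar>b x\<bar> \<le> K x\<close> give \<open>(A x u - u')' > 0\<close> once \<open>a A\<close> exceeds
  both \<open>l\<close> and \<open>K\<close>. Linear growth is the right rate: for \<open>b x = - K x\<close>, \<open>u\<close> grows like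
  \<open>exp (K x\<^sup>2 / (2 a))\<close> up to a power of \<open>x\<close>.
\<close>

lemma log_derivative_bound:
  assumes "0 < l"
  obtains A where "0 \<le> A" "\<And>x. 0 \<le> x \<Longrightarrow> u' l x \<le> A * x * u l x"
proof
  define A where "A = (l + K) / a + 1"
  have A: "0 \<le> A" "a * A = l + K + a"
    using a_pos assms K_nonneg by (auto simp: A_def field_simps)
  show "0 \<le> A"
    by fact
  fix x :: real assume x: "0 \<le> x"
  let ?f = "\<lambda>x. A * x * u l x - u' l x"
  let ?f' = "\<lambda>x. A * u l x + A * x * u' l x - u'' l x"
  have "0 \<le> ?f x"
  proof (rule nonneg_if_increasing_at_zeros[where f = ?f and f' = ?f' and y = "x + 1"])
    fix z :: real assume z: "0 \<le> z"
    show "(?f has_real_derivative ?f' z) (at z)"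
      using assms by (auto intro!: derivative_eq_intros du du' simp: algebra_simps)
    assume "?f z = 0"
    then have u'z: "u' l z = A * z * u l z"
      by simp
    have "a * ?f' z = a * A * u l z + a * A * z * u' l z - a * u'' l z"
      by (simp add: algebra_simps)
    also have "a * u'' l z = l * u l z - b z * u' l z"
      using eigen[OF assms, of z] by simp
    also have "a * A * u l z + a * A * z * u' l z - (l * u l z - b z * u' l z)
        = u l z * (K + a + A * z * ((l + a) * z + (K * z + b z)))"
      by (simp only: u'z A) (simp add: algebra_simps)
    also have "\<dots> > 0"
    proof -
      have "0 \<le> K * z + b z"
        using drift_bound[OF z] by simp
      then have "0 \<le> A * z * ((l + a) * z + (K * z + b z))"
        using A z assms a_pos by (intro mult_nonneg_nonneg add_nonneg_nonneg[of "(l + a) * z"]) auto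
      then show ?thesis
        using u_pos[OF assms, of z] a_pos K_nonneg by simp
    qed
    finally show "0 < ?f' z"
      using a_pos by (simp add: zero_less_mult_iff)
  qed (use x assms u'_0 in auto)
  then show "u' l x \<le> A * x * u l x"
    by simp
qed

text \<open>
  A quadratic weight costs no more than an increase of the parameter, which replaces moment
  estimates for the diffusion: once every \<open>u m\<close> has finite expectation, so has
  \<open>(1 + x\<^sup>2) u l\<close>. The reason is that the diffusion operator applied to
  \<open>(1 + x\<^sup>2) u l\<close> produces \<open>l (1 + x\<^sup>2) u l\<close> plus constant multiples of \<open>u\<close>, \<open>x u'\<close> and \<open>x b u\<close>,
  and the last two are at most a constant times \<open>x\<^sup>2 u\<close>.
\<close>

lemma quadratic_weight_absorbed:
  assumes "0 < l"
  obtains m where "0 < m" "\<And>x. (1 + x\<^sup>2) * u l x \<le> 2 * u m x"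
proof -
  obtain A where A: "0 \<le> A" "\<And>x. 0 \<le> x \<Longrightarrow> u' l x \<le> A * x * u l x"
    using log_derivative_bound[OF assms] by blast
  \<comment> \<open>The increments of \<open>m\<close> absorb \<open>a (x\<^sup>2)''\<close>, \<open>2 x b\<close> and the mixed term \<open>4 a x u'\<close>, in this order.\<close>
  define m where "m = l + 2 * a + 2 * K + 4 * a * A"
  have m: "0 < m" "l \<le> m"
    using A assms a_pos K_nonneg by (auto simp: m_def add_pos_nonneg)
  have "(1 + x\<^sup>2) * u l x \<le> 2 * u m x" for x
  proof -
    define w where "w x = 2 * u m x - (1 + x\<^sup>2) * u l x" for x
    define w' where "w' x = 2 * u' m x - (2 * x * u l x + (1 + x\<^sup>2) * u' l x)" for x
    define w'' where
      "w'' x = 2 * u'' m x - (2 * u l x + 4 * x * u' l x + (1 + x\<^sup>2) * u'' l x)" for x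
    have "0 < w \<bar>x\<bar>"
    proof (rule subsolution_positive(1)[where a = a and l = m and w = w and w' = w' and w'' = w'' and b = b])
      fix z :: real assume z: "0 \<le> z"
      show "(w has_real_derivative w' z) (at z)" "(w' has_real_derivative w'' z) (at z)"
        unfolding w_def w'_def w''_def using assms m
        by (auto intro!: derivative_eq_intros du du' simp: algebra_simps)
      have 1: "z * u' l z \<le> A * z\<^sup>2 * u l z"
        using mult_left_mono[OF A(2)[OF z] z] by (simp add: power2_eq_square algebra_simps)
      have 2: "z * b z \<le> K * z\<^sup>2"
        using mult_left_mono[of "b z" "K * z" z] drift_bound[OF z] z
        by (simp add: power2_eq_square algebra_simps)
      have "a * w'' z + b z * w' z =
          2 * (a * u'' m z + b z * u' m z) - (1 + z\<^sup>2) * (a * u'' l z + b z * u' l z)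
          - 2 * a * u l z - 4 * a * (z * u' l z) - 2 * (z * b z) * u l z"
        by (simp add: w''_def w'_def algebra_simps)
      also have "\<dots> = 2 * (m * u m z) - (1 + z\<^sup>2) * (l * u l z)
          - 2 * a * u l z - 4 * a * (z * u' l z) - 2 * (z * b z) * u l z"
        using assms m by (simp add: eigen)
      also have "\<dots> \<ge> 2 * (m * u m z) - (1 + z\<^sup>2) * (l * u l z)
          - 2 * a * u l z - 4 * a * (A * z\<^sup>2 * u l z) - 2 * (K * z\<^sup>2) * u l z"
        using 1 2 a_pos u_pos[OF assms, of z]
        by (intro diff_mono[OF diff_mono[OF order_refl]] mult_right_mono mult_left_mono) auto
      also have "2 * (m * u m z) - (1 + z\<^sup>2) * (l * u l z)
          - 2 * a * u l z - 4 * a * (A * z\<^sup>2 * u l z) - 2 * (K * z\<^sup>2) * u l z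
          = m * w z + u l z * (2 * a * z\<^sup>2 + 2 * K + 4 * a * A)"
        by (simp add: w_def m_def algebra_simps)
      also have "\<dots> \<ge> m * w z"
        using a_pos A K_nonneg u_pos[OF assms, of z] by simp
      finally show "m * w z \<le> a * w'' z + b z * w' z" .
    qed (use assms m a_pos in \<open>auto simp: w_def w'_def u_0 u'_0\<close>)
    with m assms show ?thesis
      by (simp add: w_def u_abs)
  qed
  with m that show ?thesis
    by blast
qed

end

section \<open>Integrals of primitives\<close>

text \<open>
  Fubini's theorem in a form where only the integral of \<open>f\<close> against the absolute mass of the kernel
  has to be controlled. For the two kernels used below this mass is \<open>\<bar>y\<bar>\<close> and \<open>max 0 (x - y)\<close>,
  which is why first moments of the density matter.
\<close>

lemma kernel_integral:
  fixes \<kappa> :: "real \<Rightarrow> real \<Rightarrow> real" and f :: "real \<Rightarrow> real"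
  assumes [measurable]: "(\<lambda>(y, z). \<kappa> z y) \<in> borel_measurable (lborel \<Otimes>\<^sub>M lborel)"
    "f \<in> borel_measurable lborel"
    and \<kappa>: "\<And>y. integrable lborel (\<lambda>z. \<kappa> z y)"
    and weight: "integrable lborel (\<lambda>y. (LBINT z. \<bar>\<kappa> z y\<bar>) * f y)"
  shows "integrable lborel (\<lambda>z. LBINT y. \<kappa> z y * f y)"
    and "(LBINT z. (LBINT y. \<kappa> z y * f y)) = (LBINT y. (LBINT z. \<kappa> z y) * f y)"
proof -
  have *: "integrable (lborel \<Otimes>\<^sub>M lborel) (\<lambda>(y, z). \<kappa> z y * f y)"
  proof (rule lborel_pair.Fubini_integrable)
    have "(LBINT z. norm (\<kappa> z y * f y)) = norm ((LBINT z. \<bar>\<kappa> z y\<bar>) * f y)" for y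
      by (simp add: abs_mult)
    then show "integrable lborel (\<lambda>y. LBINT z. norm (case (y, z) of (y, z) \<Rightarrow> \<kappa> z y * f y))"
      using integrable_norm[OF weight] by simp
    show "AE y in lborel. integrable lborel (\<lambda>z. case (y, z) of (y, z) \<Rightarrow> \<kappa> z y * f y)"
      using \<kappa> by simp
  qed measurable
  show "integrable lborel (\<lambda>z. LBINT y. \<kappa> z y * f y)"
    using lborel_pair.integrable_snd[OF *] .
  show "(LBINT z. (LBINT y. \<kappa> z y * f y)) = (LBINT y. (LBINT z. \<kappa> z y) * f y)"
    using lborel_pair.Fubini_integral[OF *] by simp
qed

text \<open>
  As \<open>f\<close> has total integral \<open>0\<close>, its primitive is unchanged when \<open>indicator {..z} y\<close> is replaced by
  \<open>indicator {..z} y - indicator {..z} 0\<close>. For fixed \<open>y\<close> the new kernel is supported, as a function of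
  \<open>z\<close>, between \<open>0\<close> and \<open>y\<close>, so its integral is \<open>- y\<close> and Fubini's theorem needs only a first
  moment.
\<close>

lemma integral_primitive_of_null_function:
  fixes f :: "real \<Rightarrow> real"
  assumes f: "integrable lborel f" and yf: "integrable lborel (\<lambda>y. y * f y)"
    and null: "(LBINT y. f y) = 0"
  shows "integrable lborel (\<lambda>z. LBINT y:{..z}. f y)"
    and "(LBINT z. (LBINT y:{..z}. f y)) = - (LBINT y. y * f y)"
proof -
  define \<kappa> :: "real \<Rightarrow> real \<Rightarrow> real" where
    "\<kappa> z y = indicator {..z} y - indicator {..z} 0" for z y
  have \<kappa>_eq: "\<kappa> z y = indicator {y..<0} z - indicator {0..<y} z" for z y
    by (auto simp: \<kappa>_def indicator_def)
  have \<kappa>_abs: "\<bar>\<kappa> z y\<bar> = indicator {y..<0} z + indicator {0..<y} z" for z y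
    by (auto simp: \<kappa>_def indicator_def)
  have \<kappa>_int: "(LBINT z. \<kappa> z y) = - y" "(LBINT z. \<bar>\<kappa> z y\<bar>) = \<bar>y\<bar>" for y
    unfolding \<kappa>_abs unfolding \<kappa>_eq by (cases "y \<le> 0"; simp)+
  have [measurable]: "f \<in> borel_measurable lborel"
    using f by simp
  have primitive: "(LBINT y. \<kappa> z y * f y) = (LBINT y:{..z}. f y)" for z
  proof -
    have "(LBINT y. \<kappa> z y * f y) = (LBINT y. indicator {..z} y * f y - indicator {..z} 0 * f y)"
      by (simp add: \<kappa>_def algebra_simps)
    also have "\<dots> = (LBINT y:{..z}. f y) - indicator {..z} 0 * (LBINT y. f y)"
      using f integrable_mult_indicator[of "{..z}" lborel f]
      by (simp add: set_lebesgue_integral_def)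
    finally show ?thesis
      by (simp add: null)
  qed
  have "integrable lborel (\<lambda>y. \<bar>y\<bar> * f y)"
    by (rule Bochner_Integration.integrable_bound[OF yf]) (auto simp: abs_mult)
  then have "integrable lborel (\<lambda>y. (LBINT z. \<bar>\<kappa> z y\<bar>) * f y)"
    by (simp add: \<kappa>_int)
  moreover have "integrable lborel (\<lambda>z. \<kappa> z y)" for y
    unfolding \<kappa>_eq by (cases "y \<le> 0") simp_all
  moreover have "(\<lambda>(y, z). \<kappa> z y) \<in> borel_measurable (lborel \<Otimes>\<^sub>M lborel)"
    unfolding \<kappa>_def indicator_def by simp
  ultimately show "integrable lborel (\<lambda>z. LBINT y:{..z}. f y)"
    "(LBINT z. (LBINT y:{..z}. f y)) = - (LBINT y. y * f y)"
    using kernel_integral[of \<kappa> f] by (simp_all add: primitive \<kappa>_int)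
qed

lemma integral_primitive_atMost:
  fixes f :: "real \<Rightarrow> real"
  assumes f: "integrable lborel f" and yf: "integrable lborel (\<lambda>y. y * f y)"
  shows "set_integrable lborel {..x} (\<lambda>z. LBINT y:{..z}. f y)"
    and "(LBINT z:{..x}. (LBINT y:{..z}. f y)) = (LBINT y. max 0 (x - y) * f y)"
proof -
  define \<kappa> :: "real \<Rightarrow> real \<Rightarrow> real" where "\<kappa> z y = indicator {y..x} z" for z y
  have \<kappa>_int: "(LBINT z. \<kappa> z y) = max 0 (x - y)" "(LBINT z. \<bar>\<kappa> z y\<bar>) = max 0 (x - y)" for y
    by (auto simp: \<kappa>_def)
  have [measurable]: "f \<in> borel_measurable lborel"
    using f by simp
  have primitive: "(LBINT y. \<kappa> z y * f y) = indicator {..x} z * (LBINT y:{..z}. f y)" for z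
    by (auto simp: \<kappa>_def set_lebesgue_integral_def indicator_def intro!: Bochner_Integration.integral_cong)
  have "integrable lborel (\<lambda>y. \<bar>x\<bar> * \<bar>f y\<bar> + \<bar>y * f y\<bar>)"
    using f yf by simp
  then have "integrable lborel (\<lambda>y. max 0 (x - y) * f y)"
  proof (rule Bochner_Integration.integrable_bound)
    have "\<bar>max 0 (x - y)\<bar> * \<bar>f y\<bar> \<le> (\<bar>x\<bar> + \<bar>y\<bar>) * \<bar>f y\<bar>" for y
      by (intro mult_right_mono) auto
    then show "AE y in lborel. norm (max 0 (x - y) * f y) \<le> norm (\<bar>x\<bar> * \<bar>f y\<bar> + \<bar>y * f y\<bar>)"
      by (simp add: abs_mult distrib_right)
  qed simp
  then have "integrable lborel (\<lambda>y. (LBINT z. \<bar>\<kappa> z y\<bar>) * f y)"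
    by (simp add: \<kappa>_int)
  moreover have "integrable lborel (\<lambda>z. \<kappa> z y)" for y
    by (simp add: \<kappa>_def emeasure_lborel_Icc_eq)
  moreover have "(\<lambda>(y, z). \<kappa> z y) \<in> borel_measurable (lborel \<Otimes>\<^sub>M lborel)"
    unfolding \<kappa>_def indicator_def by simp
  ultimately show "set_integrable lborel {..x} (\<lambda>z. LBINT y:{..z}. f y)"
    "(LBINT z:{..x}. (LBINT y:{..z}. f y)) = (LBINT y. max 0 (x - y) * f y)"
    using kernel_integral[of \<kappa> f]
    by (simp_all add: primitive \<kappa>_int set_integrable_def set_lebesgue_integral_def[of _ "{..x}"])
qed

section \<open>Differentiation of weighted integrals of the tilted density\<close>

lemma exp_minus_lipschitz:
  assumes "0 \<le> s" "0 \<le> r"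
  shows "\<bar>exp (- r) - exp (- s)\<bar> \<le> \<bar>r - s :: real\<bar>"
proof -
  have "exp (- r) - exp (- s) \<le> s - r" if "0 \<le> r" "r \<le> s" for r s :: real
  proof -
    have "exp (- r) - exp (- s) = exp (- r) * (1 - exp (- (s - r)))"
      by (simp add: right_diff_distrib flip: exp_add)
    also have "\<dots> \<le> 1 * (1 - exp (- (s - r)))"
      using that by (intro mult_right_mono) auto
    also have "\<dots> \<le> s - r"
      using exp_ge_add_one_self[of "r - s"] by (simp only: minus_diff_eq mult_1_left)
    finally show ?thesis .
  qed
  from this[of r s] this[of s r] assms show ?thesis
    by (cases "r \<le> s") auto
qed

lemma lborel_integral_reflect:
  fixes f :: "real \<Rightarrow> real"
  shows "(LBINT x. f (- x)) = (LBINT x. f x)"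
  using lborel_integral_real_affine[of "-1" f 0] by simp

text \<open>Here \<open>q\<close> is the density of the base diffusion at one fixed time \<open>t\<close>.\<close>

locale tilted_even_density = even_eigenfunctions +
  fixes q :: "real \<Rightarrow> real" and t :: real
  assumes q_measurable [measurable]: "q \<in> borel_measurable borel"
    and q_nonneg: "\<And>x. 0 \<le> q x" and q_even: "\<And>x. q (- x) = q x"
    and t_nonneg: "0 \<le> t"
    and normalized: "\<And>l. 0 < l \<Longrightarrow> (LBINT x. exp (- l * t) * u l x * q x) = 1"
    and u_differentiable: "\<And>l x. 0 < l \<Longrightarrow> (\<lambda>k. u k x) differentiable (at l)"
begin

definition dens :: "real \<Rightarrow> real \<Rightarrow> real" where
  "dens l x = exp (- l * t) * u l x * q x"

definition dens' :: "real \<Rightarrow> real \<Rightarrow> real" where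
  "dens' l x = deriv (\<lambda>k. dens k x) l"

lemma u_measurable: "0 < l \<Longrightarrow> u l \<in> borel_measurable borel"
  by (intro borel_measurable_continuous_onI continuous_u)

lemma dens_measurable: "0 < l \<Longrightarrow> dens l \<in> borel_measurable borel"
  unfolding dens_def using u_measurable by simp

lemma dens_nonneg: "0 < l \<Longrightarrow> 0 \<le> dens l x"
  by (simp add: dens_def u_pos less_imp_le q_nonneg)

lemma dens_even: "0 < l \<Longrightarrow> dens l (- x) = dens l x"
  by (simp add: dens_def u_even q_even)

lemma dens_integral: "0 < l \<Longrightarrow> (LBINT x. dens l x) = 1"
  using normalized by (simp add: dens_def)

lemma dens_integrable: "0 < l \<Longrightarrow> integrable lborel (dens l)"
  using dens_integral[of l] not_integrable_integral_eq[of lborel "dens l"] by auto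

lemma quadratic_moment:
  assumes "0 < l"
  shows "integrable lborel (\<lambda>x. (1 + x\<^sup>2) * (u l x * q x))"
proof -
  obtain m where m: "0 < m" "\<And>x. (1 + x\<^sup>2) * u l x \<le> 2 * u m x"
    using quadratic_weight_absorbed[OF assms] by blast
  show ?thesis
  proof (rule Bochner_Integration.integrable_bound)
    show "integrable lborel (\<lambda>x. 2 * exp (m * t) * dens m x)"
      using dens_integrable[OF m(1)] by simp
    have "(1 + x\<^sup>2) * (u l x * q x) \<le> 2 * exp (m * t) * dens m x" for x
    proof -
      have "2 * exp (m * t) * dens m x = 2 * u m x * q x"
        by (simp add: dens_def exp_minus field_simps)
      with mult_right_mono[OF m(2)[of x] q_nonneg[of x]] show ?thesis
        by (simp add: algebra_simps)
    qed
    then show "AE x in lborel. norm ((1 + x\<^sup>2) * (u l x * q x)) \<le> norm (2 * exp (m * t) * dens m x)"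
      using assms by (auto simp: u_pos less_imp_le q_nonneg intro!: AE_I2 order_trans[OF _ abs_ge_self])
    show "(\<lambda>x. (1 + x\<^sup>2) * (u l x * q x)) \<in> borel_measurable lborel"
      using u_measurable[OF assms] by simp
  qed
qed

text \<open>
  The parameter \<open>l + 2\<close> exceeds both \<open>k\<close> and \<open>l\<close> by at least \<open>1\<close>, as the Lipschitz estimate for
  the eigenfunctions demands, and it is the same for all \<open>k\<close> near \<open>l\<close>.
\<close>

lemma dens_lipschitz_parameter:
  assumes "0 < k" "0 < l" "k \<le> l + 1"
  shows "\<bar>dens k x - dens l x\<bar> \<le> \<bar>k - l\<bar> * ((1 + t) * (u (l + 2) x * q x))"
proof -
  have "dens k x - dens l x =
      (exp (- k * t) * (u k x - u l x) + (exp (- k * t) - exp (- l * t)) * u l x) * q x"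
    by (simp add: dens_def algebra_simps)
  then have "\<bar>dens k x - dens l x\<bar> \<le>
      (\<bar>exp (- k * t) * (u k x - u l x)\<bar> + \<bar>(exp (- k * t) - exp (- l * t)) * u l x\<bar>) * q x"
    by (simp only: abs_mult[of _ "q x"] abs_of_nonneg[OF q_nonneg])
      (intro mult_right_mono abs_triangle_ineq q_nonneg)
  also have "\<dots> \<le> (1 * (\<bar>k - l\<bar> * u (l + 2) x) + (\<bar>k - l\<bar> * t) * u (l + 2) x) * q x"
    unfolding abs_mult
  proof (intro mult_right_mono add_mono mult_mono)
    show "\<bar>u k x - u l x\<bar> \<le> \<bar>k - l\<bar> * u (l + 2) x"
      using assms by (intro u_lipschitz_parameter) auto
    show "\<bar>exp (- k * t) - exp (- l * t)\<bar> \<le> \<bar>k - l\<bar> * t"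
      using exp_minus_lipschitz[of "l * t" "k * t"] assms t_nonneg
      by (simp add: abs_mult flip: left_diff_distrib)
    show "\<bar>u l x\<bar> \<le> u (l + 2) x"
      using u_mono_parameter[of l "l + 2" x] u_pos[of l x] assms by simp
  qed (use assms t_nonneg q_nonneg in auto)
  finally show ?thesis
    by (simp add: algebra_simps)
qed

lemma dens_has_derivative:
  assumes "0 < l"
  shows "((\<lambda>k. dens k x) has_real_derivative dens' l x) (at l)"
proof -
  obtain D where D: "((\<lambda>k. u k x) has_real_derivative D) (at l)"
    using u_differentiable[OF assms] by (auto simp: real_differentiable_def)
  have "((\<lambda>k. dens k x) has_real_derivative
      (exp (- l * t) * D - t * exp (- l * t) * u l x) * q x) (at l)"
    unfolding dens_def by (auto intro!: derivative_eq_intros D simp: algebra_simps)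
  then have "(\<lambda>k. dens k x) differentiable (at l)"
    by (auto simp: real_differentiable_def)
  then show ?thesis
    by (simp add: dens'_def DERIV_deriv_iff_real_differentiable)
qed

lemma difference_quotient:
  assumes "0 < l" "X \<longlonglongrightarrow> l" "\<And>n. X n \<noteq> l"
  shows "(\<lambda>n. (dens (X n) x - dens l x) / (X n - l)) \<longlonglongrightarrow> dens' l x"
proof -
  have "((\<lambda>k. (dens k x - dens l x) / (k - l)) \<longlongrightarrow> dens' l x) (at l)"
    using dens_has_derivative[OF assms(1)] by (simp add: has_field_derivative_iff)
  then show ?thesis
    unfolding tendsto_at_iff_sequentially comp_def using assms by auto
qed

lemma dens'_measurable [measurable]:
  assumes "0 < l"
  shows "dens' l \<in> borel_measurable borel"
proof (rule borel_measurable_LIMSEQ_real)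
  define X where "X = (\<lambda>n. l + inverse (real (Suc n)))"
  have X: "X \<longlonglongrightarrow> l" "X n \<noteq> l" "0 < X n" for n
    using assms LIMSEQ_inverse_real_of_nat_add[of l] by (auto simp: X_def add_pos_pos)
  show "(\<lambda>n. (dens (X n) x - dens l x) / (X n - l)) \<longlonglongrightarrow> dens' l x" for x
    by (rule difference_quotient[OF assms X(1,2)])
  show "(\<lambda>x. (dens (X n) x - dens l x) / (X n - l)) \<in> borel_measurable borel" for n
    using dens_measurable[OF X(3)] dens_measurable[OF assms] by simp
qed

text \<open>
  Dominated convergence for the difference quotients: by the Lipschitz estimate they are bounded by
  \<open>u (l + 2) q\<close> up to a constant, and this function absorbs a weight of quadratic growth. Both
  conditions of the theorem are obtained from this lemma through the choice of the weight.
\<close>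

lemma
  fixes \<psi> :: "real \<Rightarrow> real"
  assumes [measurable]: "\<psi> \<in> borel_measurable borel"
    and growth: "\<And>x. \<bar>\<psi> x\<bar> \<le> C * (1 + x\<^sup>2)" and l: "0 < l"
  shows weighted_dens_integrable: "integrable lborel (\<lambda>x. \<psi> x * dens l x)"
    and weighted_dens'_integrable: "integrable lborel (\<lambda>x. \<psi> x * dens' l x)"
    and weighted_dens_has_derivative:
      "((\<lambda>k. LBINT x. \<psi> x * dens k x) has_real_derivative (LBINT x. \<psi> x * dens' l x)) (at l)"
proof -
  have integrable_p: "integrable lborel (\<lambda>x. \<psi> x * dens k x)" if k: "0 < k" for k
  proof (rule Bochner_Integration.integrable_bound)
    show "integrable lborel (\<lambda>x. (C * exp (- k * t)) * ((1 + x\<^sup>2) * (u k x * q x)))"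
      using quadratic_moment[OF k] by simp
    show "AE x in lborel. norm (\<psi> x * dens k x)
        \<le> norm ((C * exp (- k * t)) * ((1 + x\<^sup>2) * (u k x * q x)))"
    proof (intro AE_I2)
      fix x
      have "norm (\<psi> x * dens k x) \<le> (C * (1 + x\<^sup>2)) * dens k x"
        using mult_right_mono[OF growth[of x] dens_nonneg[OF k, of x]] dens_nonneg[OF k, of x]
        by (simp add: abs_mult)
      also have "\<dots> = (C * exp (- k * t)) * ((1 + x\<^sup>2) * (u k x * q x))"
        by (simp add: dens_def algebra_simps)
      also have "\<dots> \<le> norm \<dots>"
        by simp
      finally show "norm (\<psi> x * dens k x)
          \<le> norm ((C * exp (- k * t)) * ((1 + x\<^sup>2) * (u k x * q x)))" .
    qed
    show "(\<lambda>x. \<psi> x * dens k x) \<in> borel_measurable lborel"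
      using dens_measurable[OF k] by simp
  qed
  from l show "integrable lborel (\<lambda>x. \<psi> x * dens l x)"
    by (rule integrable_p)
  \<comment> \<open>The derivative is a limit within \<open>J\<close>, where all difference quotients obey one bound.\<close>
  define J where "J = {0<..<l + 1}"
  define w where "w x = C * (1 + t) * ((1 + x\<^sup>2) * (u (l + 2) x * q x))" for x
  have w: "integrable lborel w"
    unfolding w_def using quadratic_moment[of "l + 2"] l by simp
  have dominated: "integrable lborel (\<lambda>x. \<psi> x * dens' l x) \<and>
      (\<lambda>n. LBINT x. \<psi> x * ((dens (X n) x - dens l x) / (X n - l))) \<longlonglongrightarrow> (LBINT x. \<psi> x * dens' l x)"
    if X: "X \<longlonglongrightarrow> l" "\<And>n. X n \<in> J - {l}" for X
  proof -
    have meas: "(\<lambda>x. \<psi> x * ((dens (X n) x - dens l x) / (X n - l))) \<in> borel_measurable lborel" for n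
      using dens_measurable[of "X n"] dens_measurable[OF l] X(2)[of n] by (simp add: J_def)
    have meas_lim: "(\<lambda>x. \<psi> x * dens' l x) \<in> borel_measurable lborel"
      using dens'_measurable[OF l] by simp
    have lim: "AE x in lborel.
        (\<lambda>n. \<psi> x * ((dens (X n) x - dens l x) / (X n - l))) \<longlonglongrightarrow> \<psi> x * dens' l x"
      using X by (intro AE_I2 tendsto_mult tendsto_const difference_quotient[OF l]) auto
    have bound: "\<bar>\<psi> x\<bar> * (\<bar>dens (X n) x - dens l x\<bar> / \<bar>X n - l\<bar>) \<le> w x" for n x
    proof -
      have "\<bar>dens (X n) x - dens l x\<bar> \<le> \<bar>X n - l\<bar> * ((1 + t) * (u (l + 2) x * q x))"
        using X(2)[of n] l by (intro dens_lipschitz_parameter) (auto simp: J_def)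
      then have "\<bar>dens (X n) x - dens l x\<bar> / \<bar>X n - l\<bar> \<le> (1 + t) * (u (l + 2) x * q x)"
        using X(2)[of n] by (simp add: divide_le_eq mult.commute)
      then have "\<bar>\<psi> x\<bar> * (\<bar>dens (X n) x - dens l x\<bar> / \<bar>X n - l\<bar>)
          \<le> (C * (1 + x\<^sup>2)) * ((1 + t) * (u (l + 2) x * q x))"
        by (intro mult_mono growth) (auto intro: order_trans[OF abs_ge_zero growth])
      then show ?thesis
        by (simp add: w_def algebra_simps)
    qed
    then have "AE x in lborel. norm (\<psi> x * ((dens (X n) x - dens l x) / (X n - l))) \<le> w x" for n
      by (simp add: abs_mult)
    from integrable_dominated_convergence[OF meas_lim meas w lim this]
      integral_dominated_convergence[OF meas_lim meas w lim this]
    show ?thesis ..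
  qed
  define X0 where "X0 n = l + inverse (real (Suc (Suc n)))" for n
  have "X0 \<longlonglongrightarrow> l"
    unfolding X0_def using LIMSEQ_Suc[OF LIMSEQ_inverse_real_of_nat_add[of l]] .
  moreover have "X0 n \<in> J - {l}" for n
    using l by (auto simp: X0_def J_def add_pos_pos inverse_eq_divide divide_less_eq)
  ultimately show "integrable lborel (\<lambda>x. \<psi> x * dens' l x)"
    using dominated by blast
  have "((\<lambda>k. ((LBINT x. \<psi> x * dens k x) - (LBINT x. \<psi> x * dens l x)) / (k - l))
      \<longlongrightarrow> (LBINT x. \<psi> x * dens' l x)) (at l within J)"
    unfolding tendsto_at_iff_sequentially comp_def
  proof (intro allI impI)
    fix X assume X: "\<forall>n. X n \<in> J - {l}" "X \<longlonglongrightarrow> l"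
    have "((LBINT x. \<psi> x * dens (X n) x) - (LBINT x. \<psi> x * dens l x)) / (X n - l)
        = (LBINT x. \<psi> x * ((dens (X n) x - dens l x) / (X n - l)))" for n
    proof -
      have "0 < X n"
        using X by (simp add: J_def)
      then have "(LBINT x. \<psi> x * dens (X n) x) - (LBINT x. \<psi> x * dens l x)
          = (LBINT x. \<psi> x * dens (X n) x - \<psi> x * dens l x)"
        using integrable_p l by simp
      then show ?thesis
        by (simp add: right_diff_distrib diff_divide_distrib flip: integral_divide_zero)
    qed
    then show "(\<lambda>n. ((LBINT x. \<psi> x * dens (X n) x) - (LBINT x. \<psi> x * dens l x)) / (X n - l))
        \<longlonglongrightarrow> (LBINT x. \<psi> x * dens' l x)"
      using dominated[of X] X by simp
  qed
  moreover have "at l within J = at l"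
    using l by (intro at_within_open) (auto simp: J_def)
  ultimately show
    "((\<lambda>k. LBINT x. \<psi> x * dens k x) has_real_derivative (LBINT x. \<psi> x * dens' l x)) (at l)"
    by (simp add: has_field_derivative_iff)
qed

lemma weighted_dens'_null:
  fixes \<psi> :: "real \<Rightarrow> real"
  assumes \<psi>: "\<psi> \<in> borel_measurable borel" "\<And>x. \<bar>\<psi> x\<bar> \<le> C * (1 + x\<^sup>2)" and l: "0 < l"
    and const: "\<And>k. 0 < k \<Longrightarrow> (LBINT x. \<psi> x * dens k x) = c"
  shows "(LBINT x. \<psi> x * dens' l x) = 0"
proof (rule DERIV_unique)
  show "((\<lambda>k. LBINT x. \<psi> x * dens k x) has_real_derivative (LBINT x. \<psi> x * dens' l x)) (at l)"
    using weighted_dens_has_derivative[OF \<psi> l] .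
  show "((\<lambda>k. LBINT x. \<psi> x * dens k x) has_real_derivative 0) (at l)"
    by (rule has_field_derivative_transform_within_open[of "\<lambda>_. c" _ _ "{0<..}"])
      (use l const in auto)
qed

text \<open>The factor \<open>1\<close> is the constant \<open>C\<close> of the growth condition on weights.\<close>

lemma abs_le_quadratic: "\<bar>x\<bar> \<le> 1 * (1 + x\<^sup>2)" for x :: real
  using sum_squares_bound[of "\<bar>x\<bar>" 1] by (simp add: power2_eq_square)

lemma dens_first_moment: "0 < l \<Longrightarrow> integrable lborel (\<lambda>y. y * dens l y)"
  using weighted_dens_integrable[of "\<lambda>y. y" 1 l] abs_le_quadratic by auto

lemma dens'_integrable: "0 < l \<Longrightarrow> integrable lborel (dens' l)"
  using weighted_dens'_integrable[of "\<lambda>_. 1" 1 l] by auto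

lemma dens'_first_moment: "0 < l \<Longrightarrow> integrable lborel (\<lambda>y. y * dens' l y)"
  using weighted_dens'_integrable[of "\<lambda>y. y" 1 l] abs_le_quadratic by auto

section \<open>The two integral conditions\<close>

text \<open>
  Total mass and first moment of the density are the constants \<open>1\<close> and \<open>0\<close>, so its parameter
  derivative has mass \<open>0\<close> and first moment \<open>0\<close>. As its
  mass vanishes, the integral of its primitive is minus that first moment.
\<close>

lemma integral_cdf_derivative:
  assumes l: "0 < l"
  shows "((\<lambda>k. LBINT y:{..x}. dens k y) has_real_derivative (LBINT y:{..x}. dens' l y)) (at l)"
    and "integrable lborel (\<lambda>x. LBINT y:{..x}. dens' l y)"
    and "(LBINT x. (LBINT y:{..x}. dens' l y)) = 0"
proof -
  show "((\<lambda>k. LBINT y:{..x}. dens k y) has_real_derivative (LBINT y:{..x}. dens' l y)) (at l)"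
    using weighted_dens_has_derivative[of "indicator {..x}" 1 l] l
    by (simp add: set_lebesgue_integral_def indicator_def)
  have mass: "(LBINT y. dens' l y) = 0"
    using weighted_dens'_null[of "\<lambda>_. 1" 1 l 1] l by (simp add: dens_integral)
  have odd: "(LBINT y. y * dens k y) = 0" if "0 < k" for k
    using lborel_integral_reflect[of "\<lambda>y. y * dens k y"] that by (simp add: dens_even)
  have "(LBINT y. y * dens' l y) = 0"
    by (rule weighted_dens'_null[of _ 1 _ 0]) (use l odd abs_le_quadratic in auto)
  with integral_primitive_of_null_function[OF dens'_integrable[OF l] dens'_first_moment[OF l] mass]
  show "integrable lborel (\<lambda>x. LBINT y:{..x}. dens' l y)"
    "(LBINT x. (LBINT y:{..x}. dens' l y)) = 0"
    by simp_all
qed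

text \<open>
  Single-crossing argument for the convex order. The likelihood ratio \<open>\<rho>\<close> of the two densities
  increases in \<open>\<bar>x\<bar>\<close>, and so does \<open>\<psi>\<close>. If \<open>\<rho> c = 1\<close>, then \<open>\<psi> - \<psi> c\<close> and \<open>\<rho> - 1\<close> have the same sign
  everywhere, and subtracting the constant \<open>\<psi> c\<close> does not change the difference of the integrals,
  because both densities have mass \<open>1\<close>.
\<close>

lemma even_weight_mono:
  fixes \<psi> :: "real \<Rightarrow> real"
  assumes \<psi>: "\<psi> \<in> borel_measurable borel" "\<And>x. \<bar>\<psi> x\<bar> \<le> C * (1 + x\<^sup>2)"
    and \<psi>_mono: "\<And>x y. \<bar>x\<bar> \<le> \<bar>y\<bar> \<Longrightarrow> \<psi> x \<le> \<psi> y"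
    and l: "0 < l" "l \<le> k"
  shows "(LBINT x. \<psi> x * dens l x) \<le> (LBINT x. \<psi> x * dens k x)"
proof (cases "l = k")
  case False
  with l have l: "0 < l" "l < k" "0 < k"
    by auto
  define \<rho> where "\<rho> x = exp (- (k - l) * t) * (u k x / u l x)" for x
  have dens_ratio: "dens k x = \<rho> x * dens l x" for x
    using u_pos[OF l(1), of x] by (simp add: dens_def \<rho>_def field_simps flip: exp_add)
  have \<rho>_mono: "\<rho> x \<le> \<rho> y" if "\<bar>x\<bar> \<le> \<bar>y\<bar>" for x y
    unfolding \<rho>_def using ratio_mono[OF l(1,2) that] by (intro mult_left_mono) auto
  note int = weighted_dens_integrable[OF \<psi> l(1)] weighted_dens_integrable[OF \<psi> l(3)]
    dens_integrable[OF l(1)] dens_integrable[OF l(3)]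
  show ?thesis
  proof (cases "\<exists>c. \<rho> c = 1")
    case True
    then obtain c where c: "\<rho> c = 1"
      by blast
    have "0 \<le> (\<psi> x - \<psi> c) * (dens k x - dens l x)" for x
    proof -
      have "0 \<le> (\<psi> x - \<psi> c) * (\<rho> x - 1)"
        using \<rho>_mono[of x c] \<rho>_mono[of c x] \<psi>_mono[of x c] \<psi>_mono[of c x] c
        by (cases "\<bar>x\<bar> \<le> \<bar>c\<bar>") (auto intro: mult_nonpos_nonpos mult_nonneg_nonneg)
      then have "0 \<le> (\<psi> x - \<psi> c) * (\<rho> x - 1) * dens l x"
        using dens_nonneg[OF l(1)] by simp
      then show ?thesis
        by (simp add: dens_ratio algebra_simps)
    qed
    then have "0 \<le> (LBINT x. (\<psi> x - \<psi> c) * (dens k x - dens l x))"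
      by simp
    also have "\<dots> = (LBINT x. (\<psi> x * dens k x - \<psi> x * dens l x) - (\<psi> c * dens k x - \<psi> c * dens l x))"
      by (simp add: algebra_simps)
    also have "\<dots> = (LBINT x. \<psi> x * dens k x) - (LBINT x. \<psi> x * dens l x)"
      using int by (simp add: dens_integral l)
    finally show ?thesis
      by simp
  next
    case False
    \<comment> \<open>If \<open>\<rho>\<close> never equals \<open>1\<close>, it stays below \<open>1\<close>; densities of equal mass then agree almost
      everywhere.\<close>
    have \<rho>_le: "\<rho> x \<le> 1" for x
    proof (rule ccontr)
      assume "\<not> \<rho> x \<le> 1"
      then have "1 \<le> \<rho> \<bar>x\<bar>"
        using \<rho>_mono[of x "\<bar>x\<bar>"] by simp
      moreover have "\<rho> 0 \<le> 1"
        using l t_nonneg by (simp add: \<rho>_def u_0 mult_nonpos_nonneg)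
      moreover have "continuous_on {0..\<bar>x\<bar>} \<rho>"
        unfolding \<rho>_def using l u_pos[OF l(1)]
        by (intro continuous_intros continuous_u) (auto simp: less_imp_neq[symmetric])
      ultimately obtain c where "\<rho> c = 1"
        using IVT'[of \<rho> 0 1 "\<bar>x\<bar>"] by auto
      with False show False
        by blast
    qed
    have "0 \<le> dens l x - dens k x" for x
      using mult_right_mono[OF \<rho>_le dens_nonneg[OF l(1)], of x x] by (simp add: dens_ratio)
    moreover have "(LBINT x. dens l x - dens k x) = 0"
      using int l by (simp add: dens_integral)
    ultimately have "AE x in lborel. dens l x - dens k x = 0"
      using int integral_nonneg_eq_0_iff_AE[of lborel "\<lambda>x. dens l x - dens k x"] by simp
    then have "(LBINT x. \<psi> x * dens l x) = (LBINT x. \<psi> x * dens k x)"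
      using int by (intro integral_cong_AE) auto
    then show ?thesis
      by simp
  qed
qed simp

text \<open>
  The integral of the distribution function up to \<open>x\<close> is the expected value of \<open>max 0 (x - y)\<close>.
  By evenness of the density this weight may be replaced by its even part, which increases in
  \<open>\<bar>y\<bar>\<close>, so the integral is monotone in the parameter.
\<close>

lemma integrated_cdf_derivative:
  assumes l: "0 < l"
  shows "set_integrable lborel {..x} (\<lambda>z. LBINT y:{..z}. dens l y)"
    and "(\<lambda>k. LBINT z:{..x}. (LBINT y:{..z}. dens k y)) differentiable (at l)"
    and "0 \<le> deriv (\<lambda>k. LBINT z:{..x}. (LBINT y:{..z}. dens k y)) l"
proof -
  define \<Phi> where "\<Phi> k = (LBINT z:{..x}. (LBINT y:{..z}. dens k y))" for k
  have \<Phi>: "\<Phi> k = (LBINT y. max 0 (x - y) * dens k y)" if "0 < k" for k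
    unfolding \<Phi>_def
    using integral_primitive_atMost(2)[OF dens_integrable[OF that] dens_first_moment[OF that]] .
  have growth: "\<bar>max 0 (x - y)\<bar> \<le> (\<bar>x\<bar> + 1) * (1 + y\<^sup>2)" for y
  proof -
    have "\<bar>max 0 (x - y)\<bar> \<le> \<bar>x\<bar> * 1 + \<bar>y\<bar>"
      by auto
    also have "\<dots> \<le> \<bar>x\<bar> * (1 + y\<^sup>2) + 1 * (1 + y\<^sup>2)"
      using abs_le_quadratic[of y] by (intro add_mono mult_left_mono) auto
    finally show ?thesis
      by (simp add: algebra_simps)
  qed
  have mono: "\<Phi> k \<le> \<Phi> m" if km: "0 < k" "k \<le> m" for k m
  proof -
    define \<psi> where "\<psi> y = max 0 (x - y) + max 0 (x + y)" for y
    have \<psi>_growth: "\<bar>\<psi> y\<bar> \<le> (2 * (\<bar>x\<bar> + 1)) * (1 + y\<^sup>2)" for y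
    proof -
      have "\<bar>\<psi> y\<bar> = \<bar>max 0 (x - y)\<bar> + \<bar>max 0 (x - - y)\<bar>"
        by (simp add: \<psi>_def)
      also have "\<dots> \<le> (\<bar>x\<bar> + 1) * (1 + y\<^sup>2) + (\<bar>x\<bar> + 1) * (1 + (- y)\<^sup>2)"
        by (intro add_mono growth)
      finally show ?thesis
        by (simp add: algebra_simps)
    qed
    have double: "2 * \<Phi> k = (LBINT y. \<psi> y * dens k y)" if k: "0 < k" for k
    proof -
      have "(LBINT y. max 0 (x + y) * dens k y) = \<Phi> k"
        using lborel_integral_reflect[of "\<lambda>y. max 0 (x - y) * dens k y"] k by (simp add: \<Phi> dens_even)
      moreover have "integrable lborel (\<lambda>y. max 0 (x - y) * dens k y)"
        by (rule weighted_dens_integrable[OF _ growth k]) simp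
      moreover have "integrable lborel (\<lambda>y. max 0 (x + y) * dens k y)"
        by (rule weighted_dens_integrable[OF _ _ k, where C = "\<bar>x\<bar> + 1"])
          (use growth[of "- _"] in auto)
      ultimately show ?thesis
        using k by (simp add: \<psi>_def \<Phi> distrib_right)
    qed
    have "(LBINT y. \<psi> y * dens k y) \<le> (LBINT y. \<psi> y * dens m y)"
      by (rule even_weight_mono[OF _ \<psi>_growth _ km]) (auto simp: \<psi>_def)
    with double[of k] double[of m] km show ?thesis
      by simp
  qed
  show "set_integrable lborel {..x} (\<lambda>z. LBINT y:{..z}. dens l y)"
    using integral_primitive_atMost(1)[OF dens_integrable[OF l] dens_first_moment[OF l]] .
  have "((\<lambda>k. LBINT y. max 0 (x - y) * dens k y) has_real_derivative
      (LBINT y. max 0 (x - y) * dens' l y)) (at l)"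
    by (rule weighted_dens_has_derivative[OF _ growth l]) simp
  then have deriv: "(\<Phi> has_real_derivative (LBINT y. max 0 (x - y) * dens' l y)) (at l)"
    by (rule has_field_derivative_transform_within_open[of _ _ _ "{0<..}"]) (use l \<Phi> in auto)
  then show "(\<lambda>k. LBINT z:{..x}. (LBINT y:{..z}. dens k y)) differentiable (at l)"
    unfolding \<Phi>_def real_differentiable_def by blast
  have "mono_on {0<..} \<Phi>"
    using mono by (auto intro!: mono_onI)
  then have "0 \<le> (LBINT y. max 0 (x - y) * dens' l y)"
    by (rule mono_on_imp_deriv_nonneg[OF _ deriv]) (use l in \<open>simp add: interior_open\<close>)
  with deriv show "0 \<le> deriv (\<lambda>k. LBINT z:{..x}. (LBINT y:{..z}. dens k y)) l"
    unfolding \<Phi>_def by (simp add: DERIV_imp_deriv)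
qed

end

section \<open>Application to the diffusion\<close>

lemma admissible_drift_bound:
  assumes "admissible_drift b"
  obtains K where "0 \<le> K" "\<And>x. 0 \<le> x \<Longrightarrow> \<bar>b x\<bar> \<le> K * x"
proof -
  have db: "(b has_real_derivative deriv b x) (at x)" for x
    using assms by (simp add: admissible_drift_def twice_differentiable_def
        DERIV_deriv_iff_real_differentiable)
  obtain K where K: "\<And>x. \<bar>deriv b x\<bar> \<le> K"
    using assms by (auto simp: admissible_drift_def bounded_iff)
  have "b 0 = - b (- 0)"
    using assms unfolding admissible_drift_def by blast
  then have b0: "b 0 = 0"
    by simp
  have "\<bar>b x\<bar> \<le> K * x" if x: "0 \<le> x" for x
  proof (cases "x = 0")
    case False
    with x obtain z where "b x - b 0 = (x - 0) * deriv b z"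
      using MVT2[of 0 x b "deriv b"] db by auto
    then have "\<bar>b x\<bar> = x * \<bar>deriv b z\<bar>"
      using x b0 by (simp add: abs_mult)
    also have "\<dots> \<le> x * K"
      using x K by (intro mult_left_mono) auto
    finally show ?thesis
      by (simp add: mult.commute)
  qed (simp add: b0)
  moreover have "0 \<le> K"
    using K[of 0] by simp
  ultimately show ?thesis
    using that by blast
qed

lemma deriv_even_at_zero:
  fixes f :: "real \<Rightarrow> real"
  assumes "\<And>x. f (- x) = f x" "(f has_real_derivative D) (at 0)"
  shows "D = 0"
proof -
  have "((\<lambda>x. f (- x)) has_real_derivative D * - 1) (at 0)"
    using assms(2) by (intro DERIV_chain2[where f = f]) (auto intro!: derivative_eq_intros)
  then have "(f has_real_derivative - D) (at 0)"
    by (simp add: assms(1))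
  from DERIV_unique[OF assms(2) this] show ?thesis
    by simp
qed

lemma eigenfunction_family_normalized:
  assumes b: "admissible_drift b" and h: "eigenfunction_family b \<sigma> h"
  obtains K where "even_eigenfunctions (\<sigma>\<^sup>2 / 2) K b (\<lambda>l x. h l x / h l 0)
    (\<lambda>l x. deriv (h l) x / h l 0) (\<lambda>l x. deriv (deriv (h l)) x / h l 0)"
proof -
  obtain K where K: "0 \<le> K" "\<And>x. 0 \<le> x \<Longrightarrow> \<bar>b x\<bar> \<le> K * x"
    using admissible_drift_bound[OF b] by blast
  have even: "h l (- x) = h l x" and pos: "0 < h l 0"
    and dh: "(h l has_real_derivative deriv (h l) x) (at x)"
    and dh': "(deriv (h l) has_real_derivative deriv (deriv (h l)) x) (at x)"
    and eq: "\<sigma>\<^sup>2 / 2 * deriv (deriv (h l)) x + b x * deriv (h l) x = l * h l x"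
    if "0 < l" for l x
    using h that by (simp_all add: eigenfunction_family_def twice_differentiable_def
        diffusion_operator_def DERIV_deriv_iff_real_differentiable)
  have dh0: "deriv (h l) 0 = 0" if "0 < l" for l
    using deriv_even_at_zero[OF even dh] that by simp
  \<comment> \<open>At the origin the eigenvalue equation reads \<open>\<sigma>\<^sup>2 / 2 h'' = l h > 0\<close>.\<close>
  have "\<sigma> \<noteq> 0"
    using eq[of 1 0] dh0[of 1] pos[of 1] by auto
  have "even_eigenfunctions (\<sigma>\<^sup>2 / 2) K b (\<lambda>l x. h l x / h l 0)
      (\<lambda>l x. deriv (h l) x / h l 0) (\<lambda>l x. deriv (deriv (h l)) x / h l 0)"
  proof
    fix l x :: real assume l: "0 < l"
    show "((\<lambda>x. h l x / h l 0) has_real_derivative deriv (h l) x / h l 0) (at x)"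
      by (rule DERIV_cdivide[OF dh[OF l]])
    show "((\<lambda>x. deriv (h l) x / h l 0) has_real_derivative deriv (deriv (h l)) x / h l 0) (at x)"
      by (rule DERIV_cdivide[OF dh'[OF l]])
    show "\<sigma>\<^sup>2 / 2 * (deriv (deriv (h l)) x / h l 0) + b x * (deriv (h l) x / h l 0)
        = l * (h l x / h l 0)"
      using arg_cong[OF eq[OF l, of x], of "\<lambda>z. z / h l 0"] by (simp add: add_divide_distrib)
  qed (use K \<open>\<sigma> \<noteq> 0\<close> even dh0 pos in \<open>simp_all add: less_imp_neq[symmetric]\<close>)
  then show ?thesis
    using that by blast
qed

theorem proposition1:
  fixes M :: "'a measure" and F :: "real \<Rightarrow> 'a measure"
    and W X :: "real \<Rightarrow> 'a \<Rightarrow> real"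
    and T \<sigma> :: real and b :: "real \<Rightarrow> real"
    and q :: "real \<Rightarrow> real \<Rightarrow> real \<Rightarrow> real \<Rightarrow> real"
    and h :: "real \<Rightarrow> real \<Rightarrow> real"
    and N :: "real \<Rightarrow> 'b measure" and Y :: "real \<Rightarrow> real \<Rightarrow> 'b \<Rightarrow> real"
  assumes "0 < T"
    and "admissible_drift b"
    and "filtered_prob_space M F"
    and "brownian_motion M F T W"
    and "sde_solution M F T W b \<sigma> 0 0 X"
    and "transition_density M F T W b \<sigma> q"
    and "\<And>x t. 0 < t \<Longrightarrow> t \<le> T \<Longrightarrow> q x t 0 0 = q (- x) t 0 0"
    and "eigenfunction_family b \<sigma> h"
    and "\<And>l. 0 < l \<Longrightarrow> martingale_on M F T (\<lambda>t \<omega>. exp (- l * t) * h l (X t \<omega>) / h l 0)"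
    and "\<And>l t. 0 < l \<Longrightarrow> t \<in> {0..T} \<Longrightarrow>
           prob_space.expectation M (\<lambda>\<omega>. exp (- l * t) * h l (X t \<omega>) / h l 0) = 1"
    and "\<And>l. 0 < l \<Longrightarrow> prob_space (N l)"
    and "\<And>l t. 0 < l \<Longrightarrow> t \<in> {0..T} \<Longrightarrow> Y l t \<in> borel_measurable (N l)"
    and "\<And>l. 0 < l \<Longrightarrow> AE \<omega> in N l. Y l 0 \<omega> = 0"
    and "\<And>l t. 0 < l \<Longrightarrow> 0 < t \<Longrightarrow> t \<le> T \<Longrightarrow>
           distributed (N l) lborel (Y l t) (\<lambda>x. ennreal (tilted_density q h l x t))"
    and "\<And>l x. 0 < l \<Longrightarrow> eigenfunction_sensitivity h l x = eigenfunction_sensitivity h l (- x)"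
    and "\<And>l x. 0 < l \<Longrightarrow> 0 \<le> eigenfunction_sensitivity h l x"
  shows "\<forall>l>0. \<forall>t\<in>{0..T}.
      ((\<forall>x. (\<lambda>k. tilted_cdf q h k x t) differentiable (at l)) \<and>
       integrable lborel (\<lambda>x. deriv (\<lambda>k. tilted_cdf q h k x t) l) \<and>
       (LBINT x. deriv (\<lambda>k. tilted_cdf q h k x t) l) = 0) \<and>
      (\<forall>x. set_integrable lborel {..x} (\<lambda>y. tilted_cdf q h l y t) \<and>
         (\<lambda>k. LBINT y:{..x}. tilted_cdf q h k y t) differentiable (at l) \<and>
         0 \<le> deriv (\<lambda>k. LBINT y:{..x}. tilted_cdf q h k y t) l)"
proof (intro allI impI ballI)
  fix l t :: real
  assume l: "0 < l" and t: "t \<in> {0..T}"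
  let ?P = "\<lambda>t. ((\<forall>x. (\<lambda>k. tilted_cdf q h k x t) differentiable (at l)) \<and>
       integrable lborel (\<lambda>x. deriv (\<lambda>k. tilted_cdf q h k x t) l) \<and>
       (LBINT x. deriv (\<lambda>k. tilted_cdf q h k x t) l) = 0) \<and>
      (\<forall>x. set_integrable lborel {..x} (\<lambda>y. tilted_cdf q h l y t) \<and>
         (\<lambda>k. LBINT y:{..x}. tilted_cdf q h k y t) differentiable (at l) \<and>
         0 \<le> deriv (\<lambda>k. LBINT y:{..x}. tilted_cdf q h k y t) l)"
  show "?P t"
  proof (cases "t = 0")
    case True
    have cdf: "tilted_cdf q h k y 0 = indicator {0..} y" for k y
      by (simp add: tilted_cdf_def indicator_def)
    have "set_integrable lborel {..x} (indicator {0..} :: real \<Rightarrow> real)" for x :: real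
    proof -
      have "indicator {..x} y *\<^sub>R indicator {0..} y = (indicator {0..x} y :: real)" for y
        by (auto simp: indicator_def)
      then show ?thesis
        by (simp add: set_integrable_def emeasure_lborel_Icc_eq)
    qed
    then have "?P 0"
      by (simp add: cdf)
    with True show ?thesis
      by simp
  next
    case False
    with t have t: "0 < t" "t \<le> T" "t \<in> {0..T}"
      by auto
    obtain K where "even_eigenfunctions (\<sigma>\<^sup>2 / 2) K b (\<lambda>l x. h l x / h l 0)
        (\<lambda>l x. deriv (h l) x / h l 0) (\<lambda>l x. deriv (deriv (h l)) x / h l 0)"
      using eigenfunction_family_normalized assms(2,8) by blast
    then interpret even_eigenfunctions "\<sigma>\<^sup>2 / 2" K b "\<lambda>l x. h l x / h l 0"
      "\<lambda>l x. deriv (h l) x / h l 0" "\<lambda>l x. deriv (deriv (h l)) x / h l 0" .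
    have q_nonneg: "0 \<le> q x t 0 0" for x
      using assms(6) t unfolding transition_density_def by auto
    have X: "distributed M lborel (X t) (\<lambda>x. ennreal (q x t 0 0))"
      using assms(5,6) t unfolding transition_density_def by auto
    have "(\<lambda>x. enn2real (ennreal (q x t 0 0))) \<in> borel_measurable lborel"
      using distributed_borel_measurable[OF X] by (rule measurable_compose) simp
    then have q_measurable: "(\<lambda>x. q x t 0 0) \<in> borel_measurable borel"
      using q_nonneg by simp
    interpret tilted_even_density "\<sigma>\<^sup>2 / 2" K b "\<lambda>l x. h l x / h l 0"
      "\<lambda>l x. deriv (h l) x / h l 0" "\<lambda>l x. deriv (deriv (h l)) x / h l 0" "\<lambda>x. q x t 0 0" t
    proof
      fix l :: real assume l: "0 < l"
      have "(\<lambda>x. exp (- l * t) * (h l x / h l 0)) \<in> borel_measurable lborel"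
        using borel_measurable_continuous_onI[OF continuous_u[OF l]]
        by (simp del: times_divide_eq_right)
      then have "(LBINT x. q x t 0 0 * (exp (- l * t) * (h l x / h l 0)))
          = prob_space.expectation M (\<lambda>\<omega>. exp (- l * t) * (h l (X t \<omega>) / h l 0))"
        by (intro distributed_integral[OF X] q_nonneg)
      also have "\<dots> = 1"
        using assms(10)[OF l t(3)] by (simp only: times_divide_eq_right)
      finally show "(LBINT x. exp (- l * t) * (h l x / h l 0) * q x t 0 0) = 1"
        by (simp add: mult_ac)
      have *: "(\<lambda>k. h k x) differentiable (at l)" "h l 0 \<noteq> 0" for x
        using assms(8) l by (auto simp: eigenfunction_family_def less_imp_neq[symmetric])
      show "(\<lambda>k. h k x / h k 0) differentiable (at l)" for x
        using * by (intro differentiable_divide) auto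
    qed (use q_measurable q_nonneg assms(7)[OF t(1,2)] t in auto)
    have cdf: "tilted_cdf q h k x t = (LBINT y:{..x}. dens k y)" for k x
      using False by (simp add: tilted_cdf_def tilted_density_def dens_def)
    have "deriv (\<lambda>k. tilted_cdf q h k x t) l = (LBINT y:{..x}. dens' l y)" for x
      unfolding cdf by (rule DERIV_imp_deriv[OF integral_cdf_derivative(1)[OF l]])
    moreover have "(\<lambda>k. tilted_cdf q h k x t) differentiable (at l)" for x
      unfolding cdf real_differentiable_def using integral_cdf_derivative(1)[OF l] by blast
    ultimately show ?thesis
      using integral_cdf_derivative(2,3)[OF l] integrated_cdf_derivative[OF l]
      by (simp add: cdf)
  qed
qed

end
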